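(* Let $s\in\mathbb N$, $\alpha>1/2$, $\boldsymbol\gamma\in(0,\infty)^s$. There is a constant $C(\alpha,\boldsymbol\gamma,s)>0$ such that for every $N\ge2$, every point set $P=\{\boldsymbol x_0,\dots,\boldsymbol x_{N-1}\}\subseteq[0,1]^s$ and every weight vector $\boldsymbol w=(w_0,\dots,w_{N-1})\in\mathbb R^N$, $$e(\mathcal H(K^{\cos}_{\alpha,\boldsymbol\gamma,s});P;\boldsymbol w)\ge C(\alpha,\boldsymbol\gamma,s)\frac{(\log N)^{(s-1)/2}}{N^\alpha}.$$
   Context: $r_{\alpha,\gamma}(0)=1$, $r_{\alpha,\gamma}(h)=\gamma|h|^{-2\alpha}$ ($h\ne0$). $\mathcal H(K^{\cos}_{\alpha,\boldsymbol\gamma,s})$ is the reproducing kernel Hilbert space on $[0,1]^s$ with kernel $\prod_{j=1}^s\big(1+\sum_{k\ge1}r_{\alpha,\gamma_j}(k)2\cos(\pi kx_j)\cos(\pi ky_j)\big)$ and norm $\|\cdot\|$. The weighted worst-case error is $e(\mathcal H;P;\boldsymbol w)=\sup_{f\in\mathcal H,\|f\|\le1}\big|\int_{[0,1]^s}f(\boldsymbol x)\,d\boldsymbol x-\sum_{n=0}^{N-1}w_nf(\boldsymbol x_n)\big|$. *)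

theory Defs
  imports "HOL-Analysis.Analysis"
begin

text \<open>Dimension s = CARD('n); points are real^'n, frequency vectors 'n => nat.\<close>

definition r_ag :: "real \<Rightarrow> real \<Rightarrow> nat \<Rightarrow> real" where
  "r_ag \<alpha> \<gamma> h = (if h = 0 then 1 else \<gamma> * (real h) powr (-2 * \<alpha>))"

definition r_vec :: "real \<Rightarrow> ('n::finite \<Rightarrow> real) \<Rightarrow> ('n \<Rightarrow> nat) \<Rightarrow> real" where
  "r_vec \<alpha> \<gamma> k = (\<Prod>j\<in>UNIV. r_ag \<alpha> (\<gamma> j) (k j))"

text \<open>Orthonormal cosine basis functions of L2([0,1]^s).\<close>
definition cos_basis :: "('n::finite \<Rightarrow> nat) \<Rightarrow> real^'n \<Rightarrow> real" where
  "cos_basis k x = (\<Prod>j\<in>UNIV. if k j = 0 then 1 else sqrt 2 * cos (pi * real (k j) * (x $ j)))"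

definition unit_cube :: "(real^'n::finite) set" where
  "unit_cube = {x. \<forall>i. 0 \<le> x $ i \<and> x $ i \<le> 1}"

text \<open>Unit ball of the RKHS with kernel
  prod_j (1 + sum_{k>=1} r(k) 2 cos(pi k x_j) cos(pi k y_j)):
  f = sum_k a_k cos_basis_k on [0,1]^s with norm^2 = sum_k a_k^2 / r(k) \<le> 1.\<close>
definition cos_unit_ball :: "real \<Rightarrow> ('n::finite \<Rightarrow> real) \<Rightarrow> (real^'n \<Rightarrow> real) set" where
  "cos_unit_ball \<alpha> \<gamma> = {f. \<exists>a :: ('n \<Rightarrow> nat) \<Rightarrow> real.
      (\<lambda>k. (a k)^2 / r_vec \<alpha> \<gamma> k) summable_on UNIV \<and>
      (\<Sum>\<^sub>\<infinity>k. (a k)^2 / r_vec \<alpha> \<gamma> k) \<le> 1 \<and>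
      (\<forall>x\<in>unit_cube. f x = (\<Sum>\<^sub>\<infinity>k. a k * cos_basis k x))}"

definition wce_cos :: "real \<Rightarrow> ('n::finite \<Rightarrow> real) \<Rightarrow> nat \<Rightarrow> (nat \<Rightarrow> real^'n) \<Rightarrow> (nat \<Rightarrow> real) \<Rightarrow> real" where
  "wce_cos \<alpha> \<gamma> N P w = Sup {\<bar>integral unit_cube f - (\<Sum>n<N. w n * f (P n))\<bar> | f. f \<in> cos_unit_ball \<alpha> \<gamma>}"

end

theory Submission
  imports Defs
begin

text \<open>
  Choose \<open>n\<close> with \<open>2N \<le> 2\<^sup>n \<le> 4N\<close>. For every \<open>m\<close> with \<open>m\<^sub>1 + \<dots> + m\<^sub>s = n\<close>, the cosine polynomials with
  frequencies \<open>k\<^sub>j < 2^m\<^sub>j\<close> that vanish at the nodes form a space of dimension at least \<open>2\<^sup>n / 2\<close>. The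
  diagonal of its reproducing kernel, divided by \<open>2\<^sup>n\<close>, is a cosine polynomial that vanishes at the
  nodes, has integral at least \<open>1/2\<close>, frequencies below \<open>2 * 2^m\<^sub>j\<close> and bounded \<open>L\<^sup>2\<close> norm. Let \<open>F\<close> be
  the sum of these polynomials over all \<open>t \<approx> n^(s-1)\<close> vectors \<open>m\<close>; its integral is at least \<open>t/2\<close>.
  If \<open>|h|\<close> has dyadic size \<open>2\<^sup>l\<close> coordinatewise, then only the at most \<open>(q+1)\<^sup>s\<close> vectors
  \<open>m \<ge> l\<close> contribute to the coefficient at \<open>h\<close>, where \<open>q = n - l\<^sub>1 - \<dots> - l\<^sub>s\<close>, while the weight \<open>1/r(h)\<close> is
  of order \<open>2^(2\<alpha>(n-q))\<close>. The exponential gain in \<open>q\<close> absorbs the polynomial loss of Cauchy--Schwarz, so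
  \<open>\<parallel>F\<parallel>\<^sup>2\<close> is at most a constant times \<open>2^(2\<alpha>n) t\<close>, and \<open>F / \<parallel>F\<parallel>\<close> gives the bound.
\<close>

subsection \<open>Projections annihilating given vectors\<close>

text \<open>Induction on \<open>N\<close>: unless the current projection already annihilates the
  next vector, the rank-one projection onto the image of that vector is subtracted, and the trace
  drops by exactly 1. Subspaces are encoded as symmetric idempotent matrices, with the trace in the
  role of the dimension.\<close>

lemma exists_projection_annihilating:
  fixes v :: "nat \<Rightarrow> 'i \<Rightarrow> real"
  assumes I: "finite I"
  shows "\<exists>Q. (\<forall>i j. Q i j = Q j i) \<and> (\<forall>i\<in>I. \<forall>k\<in>I. (\<Sum>j\<in>I. Q i j * Q j k) = Q i k)
     \<and> (\<forall>n<N. \<forall>i\<in>I. (\<Sum>j\<in>I. Q i j * v n j) = 0)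
     \<and> real (card I) - real N \<le> (\<Sum>i\<in>I. Q i i) \<and> (\<Sum>i\<in>I. Q i i) \<le> real (card I)"
proof (induction N)
  case 0
  have "(\<Sum>j\<in>I. of_bool (i = j) * u j) = (if i \<in> I then u i else 0)" for i and u :: "'i \<Rightarrow> real"
  proof -
    have "(\<Sum>j\<in>I. of_bool (i = j) * u j) = (\<Sum>j\<in>I. if i = j then u j else 0)"
      by (rule sum.cong) auto
    with I show ?thesis by simp
  qed
  then show ?case by (intro exI[of _ "\<lambda>i j. of_bool (i = j)"]) auto
next
  case (Suc N)
  then obtain Q where sym: "\<And>i j. Q i j = Q j i"
    and idem: "\<And>i k. i \<in> I \<Longrightarrow> k \<in> I \<Longrightarrow> (\<Sum>j\<in>I. Q i j * Q j k) = Q i k"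
    and ann: "\<And>n i. n < N \<Longrightarrow> i \<in> I \<Longrightarrow> (\<Sum>j\<in>I. Q i j * v n j) = 0"
    and tr: "real (card I) - real N \<le> (\<Sum>i\<in>I. Q i i)" "(\<Sum>i\<in>I. Q i i) \<le> real (card I)"
    by blast
  define w where "w i = (\<Sum>j\<in>I. Q i j * v N j)" for i
  define L where "L = (\<Sum>i\<in>I. w i * w i)"
  show ?case
  proof (cases "L = 0")
    case True
    then have "\<And>i. i \<in> I \<Longrightarrow> w i = 0"
      using I by (auto simp: L_def sum_nonneg_eq_0_iff)
    with ann have "\<And>n i. n < Suc N \<Longrightarrow> i \<in> I \<Longrightarrow> (\<Sum>j\<in>I. Q i j * v n j) = 0"
      by (auto simp: less_Suc_eq w_def)
    with sym idem tr show ?thesis by (intro exI[of _ Q]) auto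
  next
    case False
    have Qw: "(\<Sum>j\<in>I. Q i j * w j) = w i" if "i \<in> I" for i
    proof -
      have "(\<Sum>j\<in>I. Q i j * w j) = (\<Sum>j\<in>I. \<Sum>l\<in>I. Q i j * Q j l * v N l)"
        by (simp add: w_def sum_distrib_left mult.assoc)
      also have "\<dots> = (\<Sum>l\<in>I. (\<Sum>j\<in>I. Q i j * Q j l) * v N l)"
        by (subst sum.swap) (simp add: sum_distrib_right)
      also have "\<dots> = w i" using that by (simp add: idem w_def)
      finally show ?thesis .
    qed
    \<comment> \<open>\<open>Q\<close> is self-adjoint; this makes \<open>w\<close> orthogonal to
      the earlier vectors, and its product with \<open>v N\<close> equal to
      \<open>L\<close>.\<close>
    have wQ: "(\<Sum>j\<in>I. w j * u j) = (\<Sum>l\<in>I. v N l * (\<Sum>j\<in>I. Q l j * u j))" for u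
    proof -
      have "(\<Sum>j\<in>I. w j * u j) = (\<Sum>j\<in>I. \<Sum>l\<in>I. v N l * (Q l j * u j))"
        unfolding w_def sum_distrib_right by (intro sum.cong refl, subst sym) (simp add: mult_ac)
      also have "\<dots> = (\<Sum>l\<in>I. v N l * (\<Sum>j\<in>I. Q l j * u j))"
        by (subst sum.swap) (simp add: sum_distrib_left)
      finally show ?thesis .
    qed
    have wvn: "(\<Sum>j\<in>I. w j * v n j) = 0" if "n < N" for n
      using that by (simp add: wQ ann)
    have wv: "(\<Sum>j\<in>I. w j * v N j) = L"
    proof -
      have "L = (\<Sum>l\<in>I. v N l * w l)"
        unfolding L_def wQ[of w] by (intro sum.cong refl) (simp add: Qw)
      then show ?thesis by (simp add: mult.commute)
    qed
    \<comment> \<open>\<open>w\<close> lies in the range of \<open>Q\<close>, so removing the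
      orthogonal projection onto its line leaves a projection again.\<close>
    define R where "R i j = Q i j - w i * w j / L" for i j
    have "R i j = R j i" for i j using sym by (simp add: R_def mult.commute)
    moreover have "(\<Sum>j\<in>I. R i j * R j k) = R i k" if "i \<in> I" "k \<in> I" for i k
    proof -
      have ring: "(q - x * y / L) * (r - y * z / L)
          = q * r - (z / L) * (q * y) - (x / L) * (r * y) + (x * z / (L * L)) * (y * y)" for q r x y z
        by (simp add: divide_inverse algebra_simps)
      have "(\<Sum>j\<in>I. R i j * R j k)
        = (\<Sum>j\<in>I. Q i j * Q j k - (w k / L) * (Q i j * w j) - (w i / L) * (Q k j * w j)
            + (w i * w k / (L * L)) * (w j * w j))"
        by (rule sum.cong) (simp_all add: R_def ring sym[of k])
      also have "\<dots> = Q i k - (w k / L) * w i - (w i / L) * w k + (w i * w k / (L * L)) * L"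
        by (simp only: sum.distrib sum_subtractf sum_distrib_left[symmetric]
            idem[OF that] Qw[OF that(1)] Qw[OF that(2)] L_def[symmetric])
      also have "\<dots> = R i k" using False by (simp add: R_def field_simps)
      finally show ?thesis .
    qed
    moreover have "(\<Sum>j\<in>I. R i j * v n j) = 0" if "n < Suc N" "i \<in> I" for n i
    proof -
      have "(\<Sum>j\<in>I. R i j * v n j) = (\<Sum>j\<in>I. Q i j * v n j) - w i / L * (\<Sum>j\<in>I. w j * v n j)"
        by (simp add: R_def left_diff_distrib sum_subtractf sum_distrib_left mult.assoc)
      also have "\<dots> = 0"
        using that False by (cases "n = N") (auto simp: wv wvn ann less_Suc_eq simp flip: w_def)
      finally show ?thesis .
    qed
    moreover have "(\<Sum>i\<in>I. R i i) = (\<Sum>i\<in>I. Q i i) - 1"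
      using False by (simp add: R_def sum_subtractf L_def flip: sum_divide_distrib)
    ultimately show ?thesis using tr by (intro exI[of _ R]) auto
  qed
qed

subsection \<open>Products of cosines\<close>

definition cos1 :: "nat \<Rightarrow> real \<Rightarrow> real" where
  "cos1 k x = (if k = 0 then 1 else sqrt 2 * cos (pi * real k * x))"

lemma cos_basis_prod: "cos_basis k x = (\<Prod>j\<in>UNIV. cos1 (k j) (x $ j))"
  by (simp add: cos_basis_def cos1_def)

text \<open>\<open>lin_coeff a b h\<close> is the coefficient of \<open>cos1 h\<close> in the product \<open>cos1 a * cos1 b\<close>.\<close>

definition lin_coeff :: "nat \<Rightarrow> nat \<Rightarrow> nat \<Rightarrow> real" where
  "lin_coeff a b h =
    (if a = 0 \<or> b = 0 then of_bool (h = a + b)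
     else of_bool (h = a + b) / sqrt 2
       + of_bool (h = max a b - min a b) / (if a = b then 1 else sqrt 2))"

lemma lin_coeff_nonneg: "lin_coeff a b h \<ge> 0"
  by (simp add: lin_coeff_def)

lemma lin_coeff_le: "lin_coeff a b h \<le> of_bool (h = a + b) + of_bool (h = max a b - min a b)"
  by (auto simp: lin_coeff_def)

text \<open>This is orthonormality of the \<open>cos1\<close>: the coefficient of a product at 0 is
  its mean over the unit interval.\<close>

lemma lin_coeff_0: "lin_coeff a b 0 = of_bool (a = b)"
  by (auto simp: lin_coeff_def)

lemma sum_of_bool_eq_le: "finite S \<Longrightarrow> (\<Sum>h\<in>S. of_bool (h = c)) \<le> (1::real)"
  by (simp add: of_bool_def)

text \<open>A product of two cosines has at most two frequencies, each with coefficient at most 1.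
  Together with \<open>sum_lin_coeff_le'\<close>, which sums over a factor instead, this supplies
  the two sides of a Schur-type estimate.\<close>

lemma sum_lin_coeff_le:
  assumes "finite S"
  shows "(\<Sum>h\<in>S. lin_coeff a b h) \<le> 2"
proof -
  have "(\<Sum>h\<in>S. lin_coeff a b h)
      \<le> (\<Sum>h\<in>S. of_bool (h = a + b)) + (\<Sum>h\<in>S. of_bool (h = max a b - min a b))"
    unfolding sum.distrib[symmetric] by (intro sum_mono lin_coeff_le)
  with sum_of_bool_eq_le[OF assms, of "a + b"] sum_of_bool_eq_le[OF assms, of "max a b - min a b"]
  show ?thesis by linarith
qed

text \<open>For given \<open>a\<close> and \<open>h\<close>, the other factor can only be
  \<open>h - a\<close>, \<open>a + h\<close> or \<open>a - h\<close>; where the subtraction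
  truncates, the extra term merely enlarges the bound.\<close>

lemma sum_lin_coeff_le':
  assumes "finite S"
  shows "(\<Sum>b\<in>S. lin_coeff a b h) \<le> 3"
proof -
  have "lin_coeff a b h \<le> of_bool (b = h - a) + of_bool (b = a + h) + of_bool (b = a - h)" for b
  proof -
    have "of_bool (h = a + b) \<le> (of_bool (b = h - a) :: real)" by simp
    moreover have "h = max a b - min a b \<Longrightarrow> b = a + h \<or> b = a - h" by linarith
    then have "of_bool (h = max a b - min a b) \<le> (of_bool (b = a + h) + of_bool (b = a - h) :: real)"
      by (cases "h = max a b - min a b") auto
    ultimately show ?thesis using lin_coeff_le[of a b h] by linarith
  qed
  then have "(\<Sum>b\<in>S. lin_coeff a b h)
      \<le> (\<Sum>b\<in>S. of_bool (b = h - a)) + (\<Sum>b\<in>S. of_bool (b = a + h)) + (\<Sum>b\<in>S. of_bool (b = a - h))"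
    unfolding sum.distrib[symmetric] by (intro sum_mono)
  with sum_of_bool_eq_le[OF assms, of "h - a"] sum_of_bool_eq_le[OF assms, of "a + h"]
    sum_of_bool_eq_le[OF assms, of "a - h"]
  show ?thesis by linarith
qed

text \<open>The product-to-sum formula in the normalised basis. Sum and difference of the
  frequencies stay below \<open>2*D\<close>, which is why the frequency boxes double.\<close>

lemma cos1_mult:
  assumes "a < D" "b < D"
  shows "cos1 a x * cos1 b x = (\<Sum>h<2*D. lin_coeff a b h * cos1 h x)"
proof -
  have delta: "(\<Sum>h<2*D. of_bool (h = c) * u h) = u c" if "c < 2 * D" for c and u :: "nat \<Rightarrow> real"
  proof -
    have "(\<Sum>h<2*D. of_bool (h = c) * u h) = (\<Sum>h<2*D. if h = c then u h else 0)"
      by (rule sum.cong) auto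
    with that show ?thesis by simp
  qed
  show ?thesis
  proof (cases "a = 0 \<or> b = 0")
    case True
    then show ?thesis using assms by (auto simp: lin_coeff_def delta) (auto simp: cos1_def)
  next
    case False
    \<comment> \<open>For \<open>a = b\<close> the difference frequency is 0, where
      \<open>cos1\<close> carries no factor \<open>sqrt 2\<close>.\<close>
    define q where "q = (if a = b then 1 else sqrt 2)"
    have "(\<Sum>h<2*D. lin_coeff a b h * cos1 h x)
      = (\<Sum>h<2*D. of_bool (h = a + b) * (cos1 h x / sqrt 2))
        + (\<Sum>h<2*D. of_bool (h = max a b - min a b) * (cos1 h x / q))"
      using False by (simp add: lin_coeff_def q_def sum.distrib[symmetric] distrib_right)
    also have "\<dots> = cos1 (a + b) x / sqrt 2 + cos1 (max a b - min a b) x / q"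
      using assms by (subst (1 2) delta) auto
    also have "cos1 (a + b) x / sqrt 2 = cos (pi * a * x + pi * b * x)"
      using False by (simp add: cos1_def algebra_simps)
    also have "cos1 (max a b - min a b) x / q = cos (pi * a * x - pi * b * x)"
    proof -
      consider "a = b" | "a < b" | "b < a" by linarith
      then show ?thesis
      proof cases
        case 2
        have "cos (pi * real (b - a) * x) = cos (pi * b * x - pi * a * x)"
          using 2 by (simp add: of_nat_diff algebra_simps)
        also have "\<dots> = cos (pi * a * x - pi * b * x)"
          by (simp add: cos_diff)
        finally show ?thesis using 2 by (simp add: cos1_def q_def)
      qed (auto simp: cos1_def q_def of_nat_diff algebra_simps)
    qed
    finally show ?thesis using False by (simp add: cos1_def cos_add cos_diff)
  qed
qed

section \<open>Products over frequency boxes and the fooling polynomial of one box\<close>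

definition freq_box :: "('n::finite \<Rightarrow> nat) \<Rightarrow> ('n \<Rightarrow> nat) set" where
  "freq_box D = (\<Pi>\<^sub>E j\<in>UNIV. {..<D j})"

lemma finite_freq_box [simp]: "finite (freq_box D)"
  by (simp add: freq_box_def finite_PiE)

lemma card_freq_box: "card (freq_box D) = (\<Prod>j\<in>UNIV. D j)"
  by (simp add: freq_box_def card_PiE)

lemma mem_freq_box: "k \<in> freq_box D \<longleftrightarrow> (\<forall>j. k j < D j)"
  by (auto simp: freq_box_def PiE_iff)

text \<open>Distributivity of product over sum; it reduces bounds over a box to one
  coordinate.\<close>

lemma sum_freq_box_prod:
  fixes u :: "'n::finite \<Rightarrow> nat \<Rightarrow> real"
  shows "(\<Sum>h\<in>freq_box D. \<Prod>j\<in>UNIV. u j (h j)) = (\<Prod>j\<in>UNIV. \<Sum>i<D j. u j i)"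
  unfolding freq_box_def by (subst prod_sum_PiE) auto

definition lin_coeffs :: "('n::finite \<Rightarrow> nat) \<Rightarrow> ('n \<Rightarrow> nat) \<Rightarrow> ('n \<Rightarrow> nat) \<Rightarrow> real" where
  "lin_coeffs k l h = (\<Prod>j\<in>UNIV. lin_coeff (k j) (l j) (h j))"

lemma lin_coeffs_nonneg: "lin_coeffs k l h \<ge> 0"
  by (simp add: lin_coeffs_def prod_nonneg lin_coeff_nonneg)

lemma lin_coeffs_0: "lin_coeffs k l (\<lambda>_. 0) = of_bool (k = l)"
  by (auto simp: lin_coeffs_def lin_coeff_0 fun_eq_iff)

lemma prod_le_power_card:
  fixes u :: "'n::finite \<Rightarrow> real"
  assumes "\<And>j. 0 \<le> u j" "\<And>j. u j \<le> c"
  shows "(\<Prod>j\<in>UNIV. u j) \<le> c ^ CARD('n)"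
  using prod_mono[of UNIV u "\<lambda>_. c"] assms by simp

lemma sum_lin_coeffs_le: "(\<Sum>h\<in>freq_box D. lin_coeffs k l h) \<le> 2 ^ CARD('n)"
  for k :: "'n::finite \<Rightarrow> nat"
  unfolding lin_coeffs_def sum_freq_box_prod[where u = "\<lambda>j. lin_coeff (k j) (l j)"]
  by (intro prod_le_power_card sum_nonneg lin_coeff_nonneg sum_lin_coeff_le) auto

lemma sum_lin_coeffs_le': "(\<Sum>l\<in>freq_box D. lin_coeffs k l h) \<le> 3 ^ CARD('n)"
  for k :: "'n::finite \<Rightarrow> nat"
  unfolding lin_coeffs_def sum_freq_box_prod[where u = "\<lambda>j i. lin_coeff (k j) i (h j)"]
  by (intro prod_le_power_card sum_nonneg lin_coeff_nonneg sum_lin_coeff_le') auto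

lemma cos_basis_mult:
  assumes "k \<in> freq_box D" "l \<in> freq_box D"
  shows "cos_basis k x * cos_basis l x
    = (\<Sum>h\<in>freq_box (\<lambda>j. 2 * D j). lin_coeffs k l h * cos_basis h x)"
proof -
  have "cos_basis k x * cos_basis l x = (\<Prod>j\<in>UNIV. cos1 (k j) (x $ j) * cos1 (l j) (x $ j))"
    by (simp add: cos_basis_prod prod.distrib)
  also have "\<dots> = (\<Prod>j\<in>UNIV. \<Sum>i<2 * D j. lin_coeff (k j) (l j) i * cos1 i (x $ j))"
    using assms by (intro prod.cong refl cos1_mult) (auto simp: mem_freq_box)
  also have "\<dots> = (\<Sum>h\<in>freq_box (\<lambda>j. 2 * D j). \<Prod>j\<in>UNIV. lin_coeff (k j) (l j) (h j) * cos1 (h j) (x $ j))"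
    by (simp add: sum_freq_box_prod[where D = "\<lambda>j. 2 * D j", symmetric])
  also have "\<dots> = (\<Sum>h\<in>freq_box (\<lambda>j. 2 * D j). lin_coeffs k l h * cos_basis h x)"
    by (simp add: lin_coeffs_def cos_basis_prod prod.distrib)
  finally show ?thesis .
qed

text \<open>The witness is the diagonal \<open>\<Sum>i u\<^sub>i(x)\<^sup>2\<close> of the reproducing kernel of the space of cosine polynomials
  with frequencies in the box that vanish at all the nodes, divided by the size of the box.\<close>

lemma exists_fooling_polynomial:
  fixes P :: "nat \<Rightarrow> real^'n::finite"
  assumes N: "2 * N \<le> (\<Prod>j\<in>UNIV. D j)" and pos: "\<And>j. D j > 0"
  shows "\<exists>b. (\<forall>n<N. (\<Sum>h\<in>freq_box (\<lambda>j. 2 * D j). b h * cos_basis h (P n)) = 0)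
    \<and> (\<forall>h. h \<notin> freq_box (\<lambda>j. 2 * D j) \<longrightarrow> b h = 0)
    \<and> b (\<lambda>_. 0) \<ge> 1/2 \<and> (\<Sum>h\<in>freq_box (\<lambda>j. 2 * D j). (b h)\<^sup>2) \<le> 6 ^ CARD('n)"
proof -
  let ?B = "freq_box D" and ?B2 = "freq_box (\<lambda>j. 2 * D j)"
  define M where "M = real (card ?B)"
  have M: "M > 0" "M \<ge> 2 * real N"
  proof -
    have "(\<Prod>j\<in>UNIV. D j) > 0" using pos by (simp add: prod_pos)
    then show "M > 0" unfolding M_def card_freq_box by linarith
    show "M \<ge> 2 * real N" using N unfolding M_def card_freq_box by linarith
  qed
  obtain Q where sym: "\<And>i j. Q i j = Q j i"
    and idem: "\<And>i k. i \<in> ?B \<Longrightarrow> k \<in> ?B \<Longrightarrow> (\<Sum>j\<in>?B. Q i j * Q j k) = Q i k"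
    and ann: "\<And>n i. n < N \<Longrightarrow> i \<in> ?B \<Longrightarrow> (\<Sum>j\<in>?B. Q i j * cos_basis j (P n)) = 0"
    and tr: "M - real N \<le> (\<Sum>i\<in>?B. Q i i)" "(\<Sum>i\<in>?B. Q i i) \<le> M"
    using exists_projection_annihilating[OF finite_freq_box, of D N "\<lambda>n k. cos_basis k (P n)"]
    unfolding M_def by blast
  \<comment> \<open>For a symmetric idempotent matrix the squared Frobenius norm equals the
    trace.\<close>
  have frob: "(\<Sum>z\<in>?B\<times>?B. (Q (fst z) (snd z))\<^sup>2) \<le> M"
  proof -
    have "(\<Sum>z\<in>?B\<times>?B. (Q (fst z) (snd z))\<^sup>2) = (\<Sum>k\<in>?B. \<Sum>l\<in>?B. Q k l * Q l k)"
      by (simp add: sum.cartesian_product case_prod_beta power2_eq_square sym)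
    also have "\<dots> = (\<Sum>k\<in>?B. Q k k)" by (simp add: idem)
    finally show ?thesis using tr by simp
  qed
  \<comment> \<open>\<open>c h\<close> is the cosine coefficient at \<open>h\<close> of the
    quadratic form of \<open>Q\<close> evaluated at the vector of basis functions.\<close>
  define c where "c h = (\<Sum>z\<in>?B\<times>?B. Q (fst z) (snd z) * lin_coeffs (fst z) (snd z) h)" for h
  define b where "b h = (if h \<in> ?B2 then c h / M else 0)" for h
  \<comment> \<open>Undoing the linearisation recovers the quadratic form, and \<open>Q\<close>
    annihilates the vector of basis values at each node.\<close>
  have zero: "(\<Sum>h\<in>?B2. b h * cos_basis h (P n)) = 0" if "n < N" for n
  proof -
    have "M * (\<Sum>h\<in>?B2. b h * cos_basis h (P n)) = (\<Sum>h\<in>?B2. c h * cos_basis h (P n))"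
      using M by (simp add: b_def sum_distrib_left cong: sum.cong)
    also have "\<dots> = (\<Sum>z\<in>?B\<times>?B. \<Sum>h\<in>?B2. Q (fst z) (snd z) * (lin_coeffs (fst z) (snd z) h * cos_basis h (P n)))"
      unfolding c_def sum_distrib_right by (subst sum.swap) (simp add: mult.assoc)
    also have "\<dots> = (\<Sum>z\<in>?B\<times>?B. Q (fst z) (snd z) * (cos_basis (fst z) (P n) * cos_basis (snd z) (P n)))"
      by (rule sum.cong) (auto simp: cos_basis_mult[of _ D] sum_distrib_left)
    also have "\<dots> = (\<Sum>k\<in>?B. cos_basis k (P n) * (\<Sum>l\<in>?B. Q k l * cos_basis l (P n)))"
      by (simp add: sum.cartesian_product case_prod_beta sum_distrib_left mult_ac)
    also have "\<dots> = 0" using that by (simp add: ann)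
    finally show ?thesis using M by simp
  qed
  \<comment> \<open>The coefficient at 0 is the trace of \<open>Q\<close> over \<open>M\<close>; the
    trace is at least \<open>M - N\<close>, and \<open>2 * N\<close> is at most
    \<open>M\<close>.\<close>
  have b0: "b (\<lambda>_. 0) \<ge> 1/2"
  proof -
    have "c (\<lambda>_. 0) = (\<Sum>k\<in>?B. \<Sum>l\<in>?B. if l = k then Q k l else 0)"
      unfolding c_def lin_coeffs_0 sum.cartesian_product case_prod_beta by (rule sum.cong) auto
    also have "\<dots> = (\<Sum>k\<in>?B. Q k k)" by simp
    finally have "c (\<lambda>_. 0) \<ge> M / 2" using tr M by simp
    then show ?thesis using M pos by (simp add: b_def mem_freq_box field_simps)
  qed
  \<comment> \<open>Each nonnegative \<open>lin_coeffs\<close> is split into two square roots before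
    Cauchy--Schwarz. The sum over \<open>l\<close> then costs \<open>3 ^ CARD('n)\<close> and the
    later sum over \<open>h\<close> costs \<open>2 ^ CARD('n)\<close>; together they give the power
    of 6.\<close>
  have cs: "(c h)\<^sup>2 \<le> (\<Sum>z\<in>?B\<times>?B. (Q (fst z) (snd z))\<^sup>2 * lin_coeffs (fst z) (snd z) h) * (3 ^ CARD('n) * M)" for h
  proof -
    have "(c h)\<^sup>2 = (\<Sum>z\<in>?B\<times>?B. (Q (fst z) (snd z) * sqrt (lin_coeffs (fst z) (snd z) h))
        * sqrt (lin_coeffs (fst z) (snd z) h))\<^sup>2"
      by (simp add: c_def mult.assoc lin_coeffs_nonneg)
    also have "\<dots> \<le> (\<Sum>z\<in>?B\<times>?B. (Q (fst z) (snd z))\<^sup>2 * lin_coeffs (fst z) (snd z) h)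
        * (\<Sum>z\<in>?B\<times>?B. lin_coeffs (fst z) (snd z) h)"
      by (rule order.trans[OF Cauchy_Schwarz_ineq_sum]) (simp add: power_mult_distrib lin_coeffs_nonneg)
    also have "(\<Sum>z\<in>?B\<times>?B. lin_coeffs (fst z) (snd z) h) = (\<Sum>k\<in>?B. \<Sum>l\<in>?B. lin_coeffs k l h)"
      by (simp add: sum.cartesian_product case_prod_beta)
    also have "\<dots> \<le> (\<Sum>k\<in>?B. 3 ^ CARD('n))" by (intro sum_mono sum_lin_coeffs_le')
    also have "\<dots> = 3 ^ CARD('n) * M" by (simp add: M_def)
    finally show ?thesis by (simp add: mult_left_mono sum_nonneg lin_coeffs_nonneg)
  qed
  have "(\<Sum>h\<in>?B2. (c h)\<^sup>2)
      \<le> (\<Sum>h\<in>?B2. (\<Sum>z\<in>?B\<times>?B. (Q (fst z) (snd z))\<^sup>2 * lin_coeffs (fst z) (snd z) h) * (3 ^ CARD('n) * M))"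
    by (intro sum_mono cs)
  also have "\<dots> = (\<Sum>z\<in>?B\<times>?B. (Q (fst z) (snd z))\<^sup>2 * (\<Sum>h\<in>?B2. lin_coeffs (fst z) (snd z) h)) * (3 ^ CARD('n) * M)"
    unfolding sum_distrib_right[symmetric] by (subst sum.swap) (simp add: sum_distrib_left)
  also have "\<dots> \<le> (\<Sum>z\<in>?B\<times>?B. (Q (fst z) (snd z))\<^sup>2 * 2 ^ CARD('n)) * (3 ^ CARD('n) * M)"
    using M by (intro mult_right_mono sum_mono mult_left_mono sum_lin_coeffs_le) auto
  also have "\<dots> \<le> (M * 2 ^ CARD('n)) * (3 ^ CARD('n) * M)"
    unfolding sum_distrib_right[symmetric] using M frob by (intro mult_right_mono) auto
  also have "\<dots> = M\<^sup>2 * 6 ^ CARD('n)"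
    by (simp add: power2_eq_square flip: power_mult_distrib)
  finally have "(\<Sum>h\<in>?B2. (c h)\<^sup>2) \<le> M\<^sup>2 * 6 ^ CARD('n)" .
  then have "(\<Sum>h\<in>?B2. (b h)\<^sup>2) \<le> 6 ^ CARD('n)"
    using M by (simp add: b_def power_divide field_simps flip: sum_divide_distrib cong: sum.cong)
  with zero b0 show ?thesis by (intro exI[of _ b]) (auto simp: b_def)
qed

subsection \<open>Integrals over the unit cube\<close>

lemma cos1_integral:
  "(\<integral>x. indicator {0..1} x * cos1 k x \<partial>lborel) = of_bool (k = 0)"
proof (cases "k = 0")
  case True
  then show ?thesis by (simp add: cos1_def)
next
  case False
  have "(\<integral>x. (sqrt 2 * cos (pi * real k * x)) * indicator {0..1} x \<partial>lborel)
     = sqrt 2 * sin (pi * real k * 1) / (pi * real k) - sqrt 2 * sin (pi * real k * 0) / (pi * real k)"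
    using False
    by (intro integral_FTC_Icc_real) (auto intro!: derivative_eq_intros continuous_intros)
  also have "\<dots> = 0"
    using sin_npi[of k] by (simp add: mult.commute)
  finally show ?thesis using False by (simp add: cos1_def mult.commute)
qed

lemma unit_cube_cbox: "unit_cube = cbox 0 (1 :: real^'n::finite)"
  by (auto simp: unit_cube_def mem_box_cart)

text \<open>Fubini for a product of one-variable functions. \<open>lborel\<close> unfolds to the
  image of a product measure indexed by basis vectors, and \<open>ix\<close> takes a basis vector
  back to its coordinate.\<close>

lemma lborel_integral_prod_components:
  fixes g :: "'n::finite \<Rightarrow> real \<Rightarrow> real"
  assumes g: "\<And>j. integrable lborel (g j)"
  shows "(\<integral>x. (\<Prod>j\<in>UNIV. g j (x $ j)) \<partial>(lborel :: (real^'n) measure)) = (\<Prod>j\<in>UNIV. \<integral>x. g j x \<partial>lborel)"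
proof -
  have inj: "inj (\<lambda>j::'n. axis j (1::real))" by (auto simp: inj_on_def axis_eq_axis)
  have Basis: "(Basis :: (real^'n) set) = range (\<lambda>j. axis j 1)"
    by (auto simp: Basis_vec_def)
  define ix where "ix = inv (\<lambda>j::'n. axis j (1::real))"
  have ix [simp]: "ix (axis j 1) = j" for j unfolding ix_def using inj by (rule inv_f_f)
  have lb: "interval_measure (\<lambda>x. x) = (lborel :: real measure)"
    by (simp add: lborel_eq_real)
  have "sigma_finite_measure (interval_measure (\<lambda>x. x))"
    unfolding lb by unfold_locales
  then interpret product_sigma_finite "\<lambda>b :: real^'n. interval_measure (\<lambda>x. x)"
    by (simp add: product_sigma_finite_def)
  have meas: "g j \<in> borel_measurable borel" for j
    using g[of j] by auto
  have "(\<integral>x. (\<Prod>j\<in>UNIV. g j (x $ j)) \<partial>(lborel :: (real^'n) measure))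
    = (\<integral>f. (\<Prod>j\<in>UNIV. g j ((\<Sum>b\<in>Basis. f b *\<^sub>R b) $ j)) \<partial>(\<Pi>\<^sub>M b\<in>(Basis :: (real^'n) set). interval_measure (\<lambda>x. x)))"
    unfolding lborel_def using meas
    by (subst integral_distr) (auto intro!: borel_measurable_prod)
  also have "\<dots> = (\<integral>f. (\<Prod>b\<in>Basis. g (ix b) (f b)) \<partial>(\<Pi>\<^sub>M b\<in>(Basis :: (real^'n) set). interval_measure (\<lambda>x. x)))"
  proof (rule Bochner_Integration.integral_cong[OF refl])
    fix f :: "real^'n \<Rightarrow> real"
    have "(\<Sum>b\<in>Basis. f b *\<^sub>R b) $ j = f (axis j 1)" for j
    proof -
      have "(\<Sum>b\<in>Basis. f b *\<^sub>R b) $ j = (\<Sum>b\<in>Basis. f b *\<^sub>R b) \<bullet> axis j 1"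
        by (simp add: inner_axis)
      also have "\<dots> = f (axis j 1)"
        by (subst inner_sum_left_Basis) (auto simp: Basis)
      finally show ?thesis .
    qed
    then show "(\<Prod>j\<in>UNIV. g j ((\<Sum>b\<in>Basis. f b *\<^sub>R b) $ j)) = (\<Prod>b\<in>Basis. g (ix b) (f b))"
      by (simp add: Basis prod.reindex[OF inj])
  qed
  also have "\<dots> = (\<Prod>b\<in>(Basis :: (real^'n) set). \<integral>x. g (ix b) x \<partial>interval_measure (\<lambda>x. x))"
    by (rule product_integral_prod) (auto simp: lb g)
  also have "\<dots> = (\<Prod>j\<in>UNIV. \<integral>x. g j x \<partial>lborel)"
    by (simp add: Basis prod.reindex[OF inj] lb)
  finally show ?thesis .
qed

lemma continuous_on_cos_basis: "continuous_on S (cos_basis k)"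
proof -
  have "continuous_on S (\<lambda>x. cos1 i (x $ j))" for i j
    by (cases "i = 0") (auto simp: cos1_def intro!: continuous_intros)
  then show ?thesis
    unfolding cos_basis_prod[abs_def] by (intro continuous_on_prod)
qed

lemma integral_cos_basis:
  "integral unit_cube (cos_basis k) = of_bool (k = (\<lambda>_. 0))"
proof -
  have int1: "integrable lborel (\<lambda>x. indicator {0..1} x * cos1 i x)" for i
  proof -
    have "continuous_on {0..1} (cos1 i)" by (cases "i = 0") (auto simp: cos1_def[abs_def] intro!: continuous_intros)
    from borel_integrable_atLeastAtMost'[OF this] show ?thesis by (simp add: set_integrable_def)
  qed
  \<comment> \<open>Continuity on a compact set allows passing from the gauge integral to the
    Lebesgue integral, for which the product formula is available.\<close>
  have "set_integrable lborel unit_cube (cos_basis k)"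
    unfolding unit_cube_cbox set_integrable_def
    by (intro borel_integrable_compact compact_cbox continuous_on_cos_basis)
  then have "integral unit_cube (cos_basis k) = (\<integral>x. indicator unit_cube x * cos_basis k x \<partial>lborel)"
    by (simp flip: set_borel_integral_eq_integral(2) add: set_lebesgue_integral_def)
  also have "\<dots> = (\<integral>x. (\<Prod>j\<in>UNIV. indicator {0..1} (x $ j) * cos1 (k j) (x $ j)) \<partial>lborel)"
    by (intro Bochner_Integration.integral_cong refl)
      (auto simp: cos_basis_prod prod.distrib unit_cube_def indicator_def)
  also have "\<dots> = (\<Prod>j\<in>UNIV. of_bool (k j = 0))"
    using lborel_integral_prod_components[OF int1, of "\<lambda>j. k j"] by (simp add: cos1_integral)
  finally show ?thesis by (auto simp: fun_eq_iff)
qed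

lemma integral_cos_polynomial:
  fixes H :: "('n::finite \<Rightarrow> nat) set"
  assumes "finite H" "(\<lambda>_. 0) \<in> H"
  shows "integral unit_cube (\<lambda>x. \<Sum>h\<in>H. a h * cos_basis h x) = a (\<lambda>_. 0)"
proof -
  have int: "cos_basis h integrable_on unit_cube" for h :: "'n \<Rightarrow> nat"
    unfolding unit_cube_cbox by (intro integrable_continuous continuous_on_cos_basis)
  have "integral unit_cube (\<lambda>x. \<Sum>h\<in>H. a h * cos_basis h x)
      = (\<Sum>h\<in>H. integral unit_cube (\<lambda>x. a h * cos_basis h x))"
    using assms int by (intro integral_sum integrable_on_mult_right) auto
  also have "\<dots> = (\<Sum>h\<in>H. if h = (\<lambda>_. 0) then a h else 0)"
    by (intro sum.cong refl) (auto simp: integral_cos_basis)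
  also have "\<dots> = a (\<lambda>_. 0)" using assms by simp
  finally show ?thesis .
qed

subsection \<open>The unit ball and the worst-case error\<close>

lemma r_ag_pos: "\<gamma> > 0 \<Longrightarrow> r_ag \<alpha> \<gamma> h > 0"
  by (simp add: r_ag_def)

lemma r_vec_pos: "\<forall>j. \<gamma> j > 0 \<Longrightarrow> r_vec \<alpha> \<gamma> k > 0"
  by (simp add: r_vec_def prod_pos r_ag_pos)

text \<open>Comparison with the series of \<open>real h powr (-2 * \<alpha>)\<close>, whose exponent
  is below -1; the exceptional value at 0 does not affect convergence.\<close>

lemma summable_r_ag:
  assumes "\<alpha> > 1/2"
  shows "summable (r_ag \<alpha> \<gamma>)"
proof -
  have "summable (\<lambda>h. \<gamma> * real h powr (-2 * \<alpha>))"
    using assms by (intro summable_mult) (simp add: summable_real_powr_iff)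
  moreover have "eventually (\<lambda>h. r_ag \<alpha> \<gamma> h = \<gamma> * real h powr (-2 * \<alpha>)) sequentially"
    using eventually_gt_at_top[of 0] by eventually_elim (simp add: r_ag_def)
  ultimately show ?thesis by (simp add: summable_cong)
qed

lemma finite_subset_freq_box:
  fixes F :: "('n::finite \<Rightarrow> nat) set"
  assumes "finite F"
  shows "\<exists>K. F \<subseteq> freq_box (\<lambda>_. K)"
proof -
  have "k j \<le> (\<Sum>k\<in>F. \<Sum>j\<in>UNIV. k j)" if "k \<in> F" for k j
  proof -
    have "k j \<le> (\<Sum>j\<in>UNIV. k j)" by (intro member_le_sum) auto
    also have "\<dots> \<le> (\<Sum>k\<in>F. \<Sum>j\<in>UNIV. k j)"
      using that assms by (intro member_le_sum[of k F "\<lambda>k. \<Sum>j\<in>UNIV. k j"]) auto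
    finally show ?thesis .
  qed
  then show ?thesis
    by (intro exI[of _ "Suc (\<Sum>k\<in>F. \<Sum>j\<in>UNIV. k j)"]) (auto simp: mem_freq_box less_Suc_eq_le)
qed

text \<open>Enlarging \<open>F\<close> to a box makes the sum factor into partial sums of the
  one-dimensional series.\<close>

lemma sum_r_vec_bounded:
  fixes \<gamma> :: "'n::finite \<Rightarrow> real"
  assumes "\<alpha> > 1/2" "\<forall>j. \<gamma> j > 0" "finite F"
  shows "(\<Sum>k\<in>F. r_vec \<alpha> \<gamma> k) \<le> (\<Prod>j\<in>UNIV. suminf (r_ag \<alpha> (\<gamma> j)))"
proof -
  obtain K where K: "F \<subseteq> freq_box (\<lambda>_. K)" using finite_subset_freq_box[OF assms(3)] by blast
  have nn: "r_ag \<alpha> (\<gamma> j) i \<ge> 0" for i j using assms r_ag_pos[of "\<gamma> j"] by (simp add: less_imp_le)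
  have "(\<Sum>k\<in>F. r_vec \<alpha> \<gamma> k) \<le> (\<Sum>k\<in>freq_box (\<lambda>_. K). r_vec \<alpha> \<gamma> k)"
    using K assms r_vec_pos[of \<gamma>] by (intro sum_mono2) (auto simp: less_imp_le)
  also have "\<dots> = (\<Prod>j\<in>UNIV. \<Sum>i<K. r_ag \<alpha> (\<gamma> j) i)"
    by (simp add: r_vec_def sum_freq_box_prod[where u = "\<lambda>j. r_ag \<alpha> (\<gamma> j)"])
  also have "\<dots> \<le> (\<Prod>j\<in>UNIV. suminf (r_ag \<alpha> (\<gamma> j)))"
    using nn assms by (intro prod_mono conjI sum_nonneg sum_le_suminf summable_r_ag) auto
  finally show ?thesis .
qed

lemma cos_basis_square_le: "(cos_basis k x)\<^sup>2 \<le> 2 ^ CARD('n)" for x :: "real^'n::finite"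
proof -
  have "(cos1 i y)\<^sup>2 \<le> 2" for i y
    by (auto simp: cos1_def power_mult_distrib abs_square_le_1)
  then show ?thesis
    unfolding cos_basis_prod prod_power_distrib by (intro prod_le_power_card) auto
qed

text \<open>Partial sums pass to the limit; for a family that is not summable \<open>infsum\<close>
  is 0, and the empty partial sum gives the bound.\<close>

lemma abs_infsum_le:
  fixes u :: "'a \<Rightarrow> real"
  assumes "\<And>F. finite F \<Longrightarrow> \<bar>sum u F\<bar> \<le> B"
  shows "\<bar>infsum u UNIV\<bar> \<le> B"
proof (cases "u summable_on UNIV")
  case True
  then have "((\<lambda>F. \<bar>sum u F\<bar>) \<longlongrightarrow> \<bar>infsum u UNIV\<bar>) (finite_subsets_at_top UNIV)"
    by (intro tendsto_rabs infsum_tendsto)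
  then show ?thesis
    by (rule tendsto_upperbound) (auto simp: assms intro: eventually_finite_subsets_at_top_weakI)
next
  case False
  then show ?thesis using assms[of "{}"] by (simp add: infsum_not_exists)
qed

text \<open>This makes the supremum in \<open>wce_cos\<close> that of a bounded set. Each term of
  the expansion is at most its share of the squared norm plus \<open>r_vec\<close> times a bounded
  factor, and both families have bounded finite sums.\<close>

lemma cos_unit_ball_bounded:
  fixes \<gamma> :: "'n::finite \<Rightarrow> real"
  assumes "\<alpha> > 1/2" "\<forall>j. \<gamma> j > 0"
  shows "\<exists>B. \<forall>f\<in>cos_unit_ball \<alpha> \<gamma>. \<forall>x\<in>unit_cube. \<bar>f x\<bar> \<le> B"
proof -
  define R where "R = (\<Prod>j\<in>UNIV. suminf (r_ag \<alpha> (\<gamma> j)))"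
  have "\<bar>f x\<bar> \<le> 1 + R * 2 ^ CARD('n)" if "f \<in> cos_unit_ball \<alpha> \<gamma>" "x \<in> unit_cube" for f x
  proof -
    from that obtain a where a: "(\<lambda>k. (a k)\<^sup>2 / r_vec \<alpha> \<gamma> k) summable_on UNIV"
      "(\<Sum>\<^sub>\<infinity>k. (a k)\<^sup>2 / r_vec \<alpha> \<gamma> k) \<le> 1" "f x = (\<Sum>\<^sub>\<infinity>k. a k * cos_basis k x)"
      by (auto simp: cos_unit_ball_def)
    have rp: "r_vec \<alpha> \<gamma> k > 0" for k using assms r_vec_pos by blast
    have "\<bar>\<Sum>k\<in>F. a k * cos_basis k x\<bar> \<le> 1 + R * 2 ^ CARD('n)" if F: "finite F" for F
    proof -
      have amgm: "\<bar>a k * cos_basis k x\<bar> \<le> (a k)\<^sup>2 / r_vec \<alpha> \<gamma> k + r_vec \<alpha> \<gamma> k * (cos_basis k x)\<^sup>2" for k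
      proof -
        let ?s = "sqrt (r_vec \<alpha> \<gamma> k)"
        have "\<bar>a k * cos_basis k x\<bar> = \<bar>a k / ?s\<bar> * \<bar>?s * cos_basis k x\<bar>"
          using rp[of k] by (simp add: abs_mult)
        also have "\<dots> \<le> \<bar>a k / ?s\<bar>\<^sup>2 + \<bar>?s * cos_basis k x\<bar>\<^sup>2"
        proof -
          have "p * q \<le> p\<^sup>2 + q\<^sup>2" if "p \<ge> 0" "q \<ge> 0" for p q :: real
            using sum_squares_bound[of p q] that mult_nonneg_nonneg[of p q] by linarith
          then show ?thesis by (meson abs_ge_zero)
        qed
        also have "\<dots> = (a k)\<^sup>2 / r_vec \<alpha> \<gamma> k + r_vec \<alpha> \<gamma> k * (cos_basis k x)\<^sup>2"
          using rp[of k] by (simp add: power_mult_distrib power_divide)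
        finally show ?thesis .
      qed
      have "\<bar>\<Sum>k\<in>F. a k * cos_basis k x\<bar> \<le> (\<Sum>k\<in>F. \<bar>a k * cos_basis k x\<bar>)" by (rule sum_abs)
      also have "\<dots> \<le> (\<Sum>k\<in>F. (a k)\<^sup>2 / r_vec \<alpha> \<gamma> k + r_vec \<alpha> \<gamma> k * 2 ^ CARD('n))"
        using rp by (intro sum_mono order.trans[OF amgm] add_left_mono mult_left_mono cos_basis_square_le)
           (simp add: less_imp_le)
      also have "\<dots> = (\<Sum>k\<in>F. (a k)\<^sup>2 / r_vec \<alpha> \<gamma> k) + (\<Sum>k\<in>F. r_vec \<alpha> \<gamma> k) * 2 ^ CARD('n)"
        by (simp add: sum.distrib sum_distrib_right)
      also have "\<dots> \<le> 1 + R * 2 ^ CARD('n)"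
      proof (intro add_mono mult_right_mono)
        have "(\<Sum>k\<in>F. (a k)\<^sup>2 / r_vec \<alpha> \<gamma> k) \<le> (\<Sum>\<^sub>\<infinity>k. (a k)\<^sup>2 / r_vec \<alpha> \<gamma> k)"
          using rp F a by (intro finite_sum_le_infsum) (auto simp: less_imp_le)
        then show "(\<Sum>k\<in>F. (a k)\<^sup>2 / r_vec \<alpha> \<gamma> k) \<le> 1" using a by simp
      qed (use sum_r_vec_bounded[OF assms F] in \<open>auto simp: R_def\<close>)
      finally show ?thesis .
    qed
    then show ?thesis unfolding a(3) by (rule abs_infsum_le)
  qed
  then show ?thesis by blast
qed

text \<open>At a function vanishing at all nodes the quadrature sum is 0, so its error is the
  absolute integral. Uniform boundedness of the ball lets the real \<open>Sup\<close> act as an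
  upper bound.\<close>

lemma wce_cos_ge:
  fixes \<gamma> :: "'n::finite \<Rightarrow> real"
  assumes \<alpha>: "\<alpha> > 1/2" and \<gamma>: "\<forall>j. \<gamma> j > 0" and P: "\<forall>n<N. P n \<in> unit_cube"
    and f: "f \<in> cos_unit_ball \<alpha> \<gamma>" and zero: "\<And>n. n < N \<Longrightarrow> f (P n) = 0"
  shows "integral unit_cube f \<le> wce_cos \<alpha> \<gamma> N P w"
proof -
  obtain B where B: "\<And>f x. f \<in> cos_unit_ball \<alpha> \<gamma> \<Longrightarrow> x \<in> unit_cube \<Longrightarrow> \<bar>f x\<bar> \<le> B"
    using cos_unit_ball_bounded[OF \<alpha> \<gamma>] by blast
  let ?S = "{\<bar>integral unit_cube f - (\<Sum>n<N. w n * f (P n))\<bar> | f. f \<in> cos_unit_ball \<alpha> \<gamma>}"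
  let ?c = "measure lborel (cbox 0 (1 :: real^'n))"
  have "0 \<in> (unit_cube :: (real^'n) set)" by (simp add: unit_cube_def)
  from B[OF f this] have B0: "B \<ge> 0" by linarith
  have "\<bar>integral unit_cube g - (\<Sum>n<N. w n * g (P n))\<bar> \<le> B * ?c + (\<Sum>n<N. \<bar>w n\<bar> * B)"
    if g: "g \<in> cos_unit_ball \<alpha> \<gamma>" for g
  proof -
    have "\<bar>integral unit_cube g\<bar> \<le> B * ?c"
    proof (cases "g integrable_on unit_cube")
      case True
      then have "(g has_integral integral unit_cube g) (cbox 0 1)"
        by (simp add: unit_cube_cbox integrable_integral)
      from has_integral_bound[OF B0 this] show ?thesis using B[OF g] by (simp add: unit_cube_cbox)
    next
      \<comment> \<open>\<open>integral\<close> of a non-integrable function is 0, so the bound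
        holds here too.\<close>
      case False
      then show ?thesis using B0 by (simp add: not_integrable_integral)
    qed
    moreover have "\<bar>\<Sum>n<N. w n * g (P n)\<bar> \<le> (\<Sum>n<N. \<bar>w n\<bar> * B)"
      by (rule order.trans[OF sum_abs]) (use P B[OF g] in \<open>auto simp: abs_mult intro!: sum_mono mult_left_mono\<close>)
    ultimately show ?thesis by linarith
  qed
  then have "bdd_above ?S" by (intro bdd_aboveI) blast
  moreover have "\<bar>integral unit_cube f - (\<Sum>n<N. w n * f (P n))\<bar> \<in> ?S" using f by blast
  ultimately have "\<bar>integral unit_cube f - (\<Sum>n<N. w n * f (P n))\<bar> \<le> Sup ?S"
    by (rule cSup_upper[rotated])
  then show ?thesis using zero by (simp add: wce_cos_def)
qed

lemma cos_polynomial_in_unit_ball: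
  fixes \<gamma> :: "'n::finite \<Rightarrow> real"
  assumes H: "finite H" and le: "(\<Sum>h\<in>H. (A h)\<^sup>2 / r_vec \<alpha> \<gamma> h) \<le> S" and S: "S > 0"
  shows "(\<lambda>x. \<Sum>h\<in>H. A h / sqrt S * cos_basis h x) \<in> cos_unit_ball \<alpha> \<gamma>"
proof -
  \<comment> \<open>Extension by zero turns both infinite sums into finite ones; dividing by
    \<open>sqrt S\<close> brings the squared norm down to at most 1.\<close>
  define a where "a h = (if h \<in> H then A h / sqrt S else 0)" for h
  have sums: "((\<lambda>k. (a k)\<^sup>2 / r_vec \<alpha> \<gamma> k) has_sum (\<Sum>h\<in>H. (a h)\<^sup>2 / r_vec \<alpha> \<gamma> h)) UNIV"
    using H by (intro has_sum_finite_neutralI) (auto simp: a_def)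
  have "(\<Sum>h\<in>H. (a h)\<^sup>2 / r_vec \<alpha> \<gamma> h) = (\<Sum>h\<in>H. (A h)\<^sup>2 / r_vec \<alpha> \<gamma> h) / S"
    using S by (simp add: a_def power_divide sum_divide_distrib mult.commute cong: sum.cong)
  also have "\<dots> \<le> 1" using le S by simp
  finally have le1: "(\<Sum>h\<in>H. (a h)\<^sup>2 / r_vec \<alpha> \<gamma> h) \<le> 1" .
  have "(\<Sum>h\<in>H. A h / sqrt S * cos_basis h x) = (\<Sum>\<^sub>\<infinity>k. a k * cos_basis k x)" for x :: "real^'n"
  proof -
    have "((\<lambda>k. a k * cos_basis k x) has_sum (\<Sum>h\<in>H. a h * cos_basis h x)) UNIV"
      using H by (intro has_sum_finite_neutralI) (auto simp: a_def)
    then show ?thesis by (simp add: infsumI a_def cong: sum.cong)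
  qed
  then show ?thesis
    using sums le1 unfolding cos_unit_ball_def
    by (auto intro!: exI[of _ a] simp: infsumI has_sum_imp_summable)
qed

subsection \<open>Counting dyadic blocks\<close>

definition level_set :: "nat \<Rightarrow> ('n::finite \<Rightarrow> nat) set" where
  "level_set n = {m. (\<Sum>j\<in>UNIV. m j) = n}"

lemma level_set_le: "m \<in> level_set n \<Longrightarrow> m j \<le> n"
  using member_le_sum[of j UNIV m] by (simp add: level_set_def)

lemma finite_level_set [simp]: "finite (level_set n)"
  by (rule finite_subset[of _ "freq_box (\<lambda>_. Suc n)"])
    (auto simp: mem_freq_box less_Suc_eq_le level_set_le)

text \<open>All coordinates but one range freely over \<open>{..n div s}\<close>, with
  \<open>s\<close> the dimension, and the last one makes up the total. This count is the source of
  the logarithm in the final bound.\<close>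

lemma card_level_set_ge:
  "(real n / real CARD('n)) ^ (CARD('n) - 1) \<le> real (card (level_set n :: ('n::finite \<Rightarrow> nat) set))"
proof -
  let ?s = "CARD('n)"
  obtain j0 :: 'n where True by blast
  let ?J = "UNIV - {j0}"
  \<comment> \<open>The truncated subtraction is exact on \<open>?X\<close>, since the free
    coordinates sum to at most \<open>n\<close>.\<close>
  define \<phi> where "\<phi> g j = (if j = j0 then n - (\<Sum>i\<in>?J. g i) else g j)" for g :: "'n \<Rightarrow> nat" and j
  let ?X = "\<Pi>\<^sub>E j\<in>?J. {..n div ?s}"
  have "inj_on \<phi> ?X"
  proof (rule inj_onI)
    fix g g' assume g: "g \<in> ?X" "g' \<in> ?X" and eq: "\<phi> g = \<phi> g'"
    have "g j = g' j" if "j \<in> ?J" for j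
      using fun_cong[OF eq, of j] that by (simp add: \<phi>_def)
    with g show "g = g'" by (intro PiE_ext)
  qed
  moreover have "\<phi> ` ?X \<subseteq> level_set n"
  proof safe
    fix g assume g: "g \<in> ?X"
    have "(\<Sum>i\<in>?J. g i) \<le> (\<Sum>i\<in>?J. n div ?s)"
      by (intro sum_mono) (use g in \<open>auto simp: PiE_iff\<close>)
    also have "\<dots> = (?s - 1) * (n div ?s)" by (simp add: card_Diff_singleton)
    also have "\<dots> \<le> ?s * (n div ?s)" by simp
    also have "\<dots> \<le> n" by simp
    finally have "(\<Sum>i\<in>?J. g i) \<le> n" .
    then have "(\<Sum>j\<in>UNIV. \<phi> g j) = n"
      by (subst sum.remove[of _ j0]) (auto simp: \<phi>_def)
    then show "\<phi> g \<in> level_set n" by (simp add: level_set_def)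
  qed
  ultimately have "card ?X \<le> card (level_set n :: ('n \<Rightarrow> nat) set)"
    by (intro card_inj_on_le) auto
  moreover have "card ?X = (n div ?s + 1) ^ (?s - 1)"
    by (simp add: card_PiE card_Diff_singleton)
  moreover have "(real n / real ?s) ^ (?s - 1) \<le> real (n div ?s + 1) ^ (?s - 1)"
  proof (rule power_mono)
    show "real n / real ?s \<le> real (n div ?s + 1)"
    proof -
      have "n < ?s + ?s * (n div ?s)" by (rule dividend_less_times_div) simp
      then have "n \<le> (n div ?s + 1) * ?s" by (simp add: algebra_simps)
      then have "real n \<le> real (n div ?s + 1) * real ?s" by (metis of_nat_le_iff of_nat_mult)
      then show ?thesis by (simp add: divide_le_eq)
    qed
  qed simp
  ultimately show ?thesis
    by (metis (mono_tags, lifting) of_nat_le_iff of_nat_power order.trans)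
qed

text \<open>With \<open>t = ln 2 / s\<close>, which is at most 1, \<open>(q + 1) * t\<close> is at
  most \<open>1 + q * t\<close> and hence at most \<open>exp (q * t)\<close>; the power
  \<open>s\<close> of this gives \<open>2 ^ q\<close>.\<close>

lemma power_le_exponential:
  assumes "s > 0"
  shows "real (q + 1) ^ s \<le> (real s / ln 2) ^ s * 2 ^ q"
proof -
  define t where "t = ln 2 / real s"
  have t: "t > 0" "t \<le> 1" using assms ln_2_less_1 by (auto simp: t_def)
  have "real (q + 1) * t \<le> 1 + real q * t" using t by (simp add: algebra_simps)
  also have "\<dots> \<le> exp (real q * t)" by (rule exp_ge_add_one_self)
  finally have "(real (q + 1) * t) ^ s \<le> exp (real q * t) ^ s"
    using t by (intro power_mono) auto
  also have "exp (real q * t) ^ s = exp (real q * ln 2)"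
    using assms by (simp add: t_def flip: exp_of_nat_mult)
  also have "\<dots> = 2 ^ q" by (simp add: exp_of_nat_mult)
  finally have "real (q + 1) ^ s * t ^ s \<le> 2 ^ q" by (simp only: power_mult_distrib)
  moreover have "t ^ s > 0" using t by simp
  ultimately have "real (q + 1) ^ s \<le> 2 ^ q / t ^ s" by (simp add: pos_le_divide_eq)
  then show ?thesis by (simp add: t_def power_divide mult.commute)
qed

text \<open>The least \<open>l\<close> with \<open>h < 2 * 2 ^ l\<close>. Membership in a doubled
  dyadic range becomes the comparison \<open>l \<le> m\<close>; the frequencies 0 and 1 both have
  level 0.\<close>

lemma dyadic_level: "\<exists>l. (\<forall>m. h < 2 * 2 ^ m \<longleftrightarrow> l \<le> m) \<and> h \<le> 2 ^ (l + 1)" for h :: nat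
proof -
  define l where "l = (LEAST m. h < 2 * 2 ^ m)"
  have "h < 2 ^ h" by (rule less_exp)
  then have "h < 2 * 2 ^ h" by linarith
  then have l: "h < 2 * 2 ^ l" unfolding l_def by (rule LeastI)
  have "h < 2 * 2 ^ m" if "l \<le> m" for m
    using l power_increasing[OF that, of "2::nat"] by linarith
  moreover have "l \<le> m" if "h < 2 * 2 ^ m" for m
    unfolding l_def using that by (rule Least_le)
  moreover have "h \<le> 2 ^ (l + 1)" using l by simp
  ultimately show ?thesis by blast
qed

text \<open>If the levels of \<open>h\<close> sum to \<open>n - q\<close>, every active
  \<open>m\<close> exceeds them by at most \<open>q\<close> per coordinate, so there are at most
  \<open>(q + 1) ^ s\<close> of them, which is of order at most
  \<open>2 powr (2 * \<alpha> * q)\<close>. The weight is of order at most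
  \<open>2 powr (2 * \<alpha> * (n - q))\<close>, and \<open>q\<close> cancels.\<close>

lemma card_active_le:
  fixes \<gamma> :: "'n::finite \<Rightarrow> real"
  assumes \<alpha>: "\<alpha> > 1/2" and \<gamma>: "\<forall>j. \<gamma> j > 0"
  shows "\<exists>E>0. \<forall>n h. real (card {m \<in> level_set n. \<forall>j. h j < 2 * 2 ^ m j}) / r_vec \<alpha> \<gamma> h
    \<le> E * 2 powr (2 * \<alpha> * real n)"
proof -
  let ?s = "CARD('n)"
  \<comment> \<open>The maximum with 1 covers the coordinates with \<open>h j = 0\<close>, where
    \<open>r_ag\<close> is 1 whatever \<gamma> is.\<close>
  define G where "G = (\<Prod>j\<in>UNIV. max 1 (1 / \<gamma> j))"
  define K where "K = (real ?s / ln 2) ^ ?s"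
  have K: "K > 0" by (simp add: K_def)
  have G: "G > 0" by (auto simp: G_def intro!: prod_pos)
  have main: "real (card {m \<in> level_set n. \<forall>j. h j < 2 * 2 ^ m j}) / r_vec \<alpha> \<gamma> h
    \<le> (K * G * 2 powr (2 * \<alpha> * real ?s)) * 2 powr (2 * \<alpha> * real n)" (is "real (card ?A) / _ \<le> _") for n h
  proof (cases "?A = {}")
    case True
    then show ?thesis using K G by (simp only: True) simp
  next
    case False
    have "\<exists>l. \<forall>j. (\<forall>m. h j < 2 * 2 ^ m \<longleftrightarrow> l j \<le> m) \<and> h j \<le> 2 ^ (l j + 1)"
      using dyadic_level by (intro choice) auto
    then obtain l where l: "\<And>j m. h j < 2 * 2 ^ m \<longleftrightarrow> l j \<le> m" "\<And>j. h j \<le> 2 ^ (l j + 1)" by blast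
    have A: "?A = {m \<in> level_set n. \<forall>j. l j \<le> m j}" by (simp add: l(1))
    define L where "L = (\<Sum>j\<in>UNIV. l j)"
    \<comment> \<open>A single active vector already forces the levels to sum to at most
      \<open>n\<close>, so that \<open>q\<close> below is a genuine difference.\<close>
    from False obtain m0 where "m0 \<in> level_set n" "\<And>j. l j \<le> m0 j" unfolding A by blast
    then have Ln: "L \<le> n" using sum_mono[of UNIV l m0] by (simp add: L_def level_set_def)
    define q where "q = n - L"
    have "?A \<subseteq> (\<Pi>\<^sub>E j\<in>UNIV. {l j..l j + q})"
    proof
      fix m assume "m \<in> ?A"
      then have m: "(\<Sum>j\<in>UNIV. m j) = n" "\<And>j. l j \<le> m j" by (auto simp: l(1) level_set_def)
      have "m j - l j \<le> q" for j
      proof -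
        have "m j - l j \<le> (\<Sum>j\<in>UNIV. m j - l j)" by (rule member_le_sum) auto
        also have "\<dots> = q" using m by (simp add: sum_subtractf_nat q_def L_def)
        finally show ?thesis .
      qed
      with m(2) show "m \<in> (\<Pi>\<^sub>E j\<in>UNIV. {l j..l j + q})"
        by (auto simp: PiE_iff) (metis add.commute le_diff_conv)
    qed
    then have "card ?A \<le> card (\<Pi>\<^sub>E j\<in>(UNIV::'n set). {l j..l j + q})"
      by (intro card_mono finite_PiE) auto
    also have "\<dots> = (q + 1) ^ ?s" by (simp add: card_PiE)
    finally have "real (card ?A) \<le> real ((q + 1) ^ ?s)" by (simp only: of_nat_le_iff)
    also have "\<dots> = real (q + 1) ^ ?s" by (simp only: of_nat_power)
    also have "\<dots> \<le> K * 2 ^ q" unfolding K_def by (rule power_le_exponential) simp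
    also have "\<dots> \<le> K * 2 powr (2 * \<alpha> * real q)"
    proof -
      \<comment> \<open>Here \<open>2 * \<alpha> > 1\<close> lets the decay of the weights dominate
        the growth of the count.\<close>
      have "(2::real) ^ q = 2 powr (1 * real q)" by (simp add: powr_realpow)
      also have "\<dots> \<le> 2 powr (2 * \<alpha> * real q)" using \<alpha> by (intro powr_mono mult_right_mono) auto
      finally show ?thesis using K by simp
    qed
    finally have cardA: "real (card ?A) \<le> K * 2 powr (2 * \<alpha> * real q)" .
    have "1 / r_vec \<alpha> \<gamma> h = (\<Prod>j\<in>UNIV. 1 / r_ag \<alpha> (\<gamma> j) (h j))"
      by (simp add: r_vec_def prod_dividef)
    also have "\<dots> \<le> (\<Prod>j\<in>UNIV. max 1 (1 / \<gamma> j) * 2 powr (2 * \<alpha> * (real (l j) + 1)))"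
    proof (intro prod_mono conjI)
      fix j
      show "0 \<le> 1 / r_ag \<alpha> (\<gamma> j) (h j)" using \<gamma> r_ag_pos[of "\<gamma> j"] by (simp add: less_imp_le)
      show "1 / r_ag \<alpha> (\<gamma> j) (h j) \<le> max 1 (1 / \<gamma> j) * 2 powr (2 * \<alpha> * (real (l j) + 1))"
      proof (cases "h j = 0")
        case True
        have "1 * 1 \<le> max 1 (1 / \<gamma> j) * 2 powr (2 * \<alpha> * (real (l j) + 1))"
          using \<alpha> by (intro mult_mono ge_one_powr_ge_zero) auto
        with True show ?thesis by (simp add: r_ag_def)
      next
        case False
        have "real (h j) \<le> 2 ^ (l j + 1)" using l(2)[of j] by (metis of_nat_le_iff of_nat_numeral of_nat_power)
        also have "\<dots> = 2 powr (real (l j) + 1)"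
          using powr_realpow[of 2 "l j + 1"] by (simp add: add.commute)
        finally have "real (h j) powr (2 * \<alpha>) \<le> (2 powr (real (l j) + 1)) powr (2 * \<alpha>)"
          using \<alpha> by (intro powr_mono2) auto
        also have "\<dots> = 2 powr (2 * \<alpha> * (real (l j) + 1))" by (simp add: powr_powr mult.commute)
        finally have hp: "real (h j) powr (2 * \<alpha>) \<le> 2 powr (2 * \<alpha> * (real (l j) + 1))" .
        have "1 / r_ag \<alpha> (\<gamma> j) (h j) = 1 / \<gamma> j * real (h j) powr (2 * \<alpha>)"
          using False by (simp add: r_ag_def powr_minus field_simps)
        also have "\<dots> \<le> max 1 (1 / \<gamma> j) * 2 powr (2 * \<alpha> * (real (l j) + 1))"
          using hp by (intro mult_mono) auto
        finally show ?thesis .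
      qed
    qed
    also have "\<dots> = G * 2 powr (2 * \<alpha> * (real L + real ?s))"
    proof -
      have "(\<Prod>j\<in>UNIV. 2 powr (2 * \<alpha> * (real (l j) + 1))) = 2 powr (\<Sum>j\<in>UNIV. 2 * \<alpha> * (real (l j) + 1))"
        by (simp add: powr_sum)
      also have "(\<Sum>j\<in>UNIV. 2 * \<alpha> * (real (l j) + 1)) = 2 * \<alpha> * (real L + real ?s)"
        by (simp add: L_def sum.distrib flip: sum_distrib_left)
      finally show ?thesis by (simp add: G_def prod.distrib)
    qed
    finally have "real (card ?A) * (1 / r_vec \<alpha> \<gamma> h)
        \<le> (K * 2 powr (2 * \<alpha> * real q)) * (G * 2 powr (2 * \<alpha> * (real L + real ?s)))"
      using cardA r_vec_pos[OF \<gamma>, of \<alpha> h] K by (intro mult_mono) auto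
    also have "\<dots> = K * G * 2 powr (2 * \<alpha> * real q + 2 * \<alpha> * (real L + real ?s))"
      by (simp add: powr_add)
    also have "2 * \<alpha> * real q + 2 * \<alpha> * (real L + real ?s) = 2 * \<alpha> * real ?s + 2 * \<alpha> * real n"
      using Ln by (simp add: q_def of_nat_diff algebra_simps)
    finally show ?thesis by (simp add: powr_add)
  qed
  show ?thesis
  proof (intro exI conjI allI)
    show "0 < K * G * 2 powr (2 * \<alpha> * real ?s)" using K G by simp
  qed (rule main)
qed

section \<open>Choice of the scale and assembly of the lower bound\<close>

text \<open>The least admissible \<open>n\<close> works. The first inequality leaves at least half
  of the dimension after \<open>N\<close> conditions, and the second costs only a factor
  \<open>4 powr \<alpha>\<close>.\<close>

lemma exists_dyadic_scale:
  assumes "N \<ge> 1"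
  shows "\<exists>n. 2 * N \<le> 2 ^ n \<and> (2::nat) ^ n \<le> 4 * N"
proof -
  define n where "n = (LEAST n. 2 * N \<le> 2 ^ n)"
  have "2 * N \<le> 2 ^ (2 * N)" by (rule less_imp_le[OF less_exp])
  then have n: "2 * N \<le> 2 ^ n" unfolding n_def by (rule LeastI)
  obtain n' where n': "n = Suc n'" using n assms by (cases n) auto
  have "\<not> 2 * N \<le> 2 ^ n'" using not_less_Least[of n' "\<lambda>n. 2 * N \<le> 2 ^ n"] n' unfolding n_def by simp
  with n n' show ?thesis by (intro exI[of _ n]) auto
qed

theorem mainTheorem11:
  fixes \<alpha> :: real and \<gamma> :: "'n::finite \<Rightarrow> real"
  assumes "\<alpha> > 1/2" and "\<forall>j. \<gamma> j > 0"
  shows "\<exists>C>0. \<forall>N::nat. \<forall>P :: nat \<Rightarrow> real^'n. \<forall>w :: nat \<Rightarrow> real.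
           N \<ge> 2 \<longrightarrow> (\<forall>n<N. P n \<in> unit_cube) \<longrightarrow>
           wce_cos \<alpha> \<gamma> N P w \<ge> C * ln (real N) powr ((real CARD('n) - 1) / 2) / real N powr \<alpha>"
proof -
  let ?s = "CARD('n)"
  define e where "e = (real ?s - 1) / 2"
  have s1: "real ?s \<ge> 1" using zero_less_card_finite[where 'a = 'n] by linarith
  have e0: "e \<ge> 0" using s1 by (simp add: e_def)
  obtain E where E: "E > 0"
    and active: "\<And>n h. real (card {m \<in> level_set n. \<forall>j. h j < 2 * 2 ^ m j}) / r_vec \<alpha> \<gamma> h
      \<le> E * 2 powr (2 * \<alpha> * real n)"
    using card_active_le[OF assms] by blast
  define E' where "E' = sqrt (E * 6 ^ ?s)"
  have E': "E' > 0" using E by (simp add: E'_def)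
  \<comment> \<open>\<open>real ?s powr e\<close> comes from counting the level set, 2 from the mean
    \<open>t / 2\<close>, \<open>E'\<close> from the norm bound, and \<open>4 powr \<alpha>\<close>
    from \<open>2 ^ n \<le> 4 * N\<close>.\<close>
  define C where "C = 1 / (real ?s powr e * (2 * E' * 4 powr \<alpha>))"
  have "C * ln (real N) powr e / real N powr \<alpha> \<le> wce_cos \<alpha> \<gamma> N P w"
    if N: "N \<ge> 2" and P: "\<forall>n<N. P n \<in> unit_cube" for N and P :: "nat \<Rightarrow> real^'n" and w
  proof -
    obtain n where n: "2 * N \<le> 2 ^ n" "(2::nat) ^ n \<le> 4 * N"
      using exists_dyadic_scale[of N] N by auto
    let ?T = "level_set n :: ('n \<Rightarrow> nat) set"
    let ?box = "\<lambda>m :: 'n \<Rightarrow> nat. freq_box (\<lambda>j. 2 * 2 ^ m j)"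
    define t where "t = real (card ?T)"
    have nlog: "ln (real N) \<le> real n"
    proof -
      have "real N \<le> 2 ^ n" using n(1) by (metis le_add2 mult_2 of_nat_le_iff of_nat_numeral of_nat_power order.trans)
      then have "ln (real N) \<le> ln (2 ^ n)" using N by simp
      also have "\<dots> = real n * ln 2" by (simp add: ln_realpow)
      also have "\<dots> \<le> real n * 1" using ln_2_less_1 by (intro mult_left_mono) auto
      finally show ?thesis by simp
    qed
    have lnN: "ln (real N) > 0" using N by simp
    \<comment> \<open>The square root appears because the mean grows like \<open>t\<close> but the
      norm only like \<open>sqrt t\<close>; hence the exponent \<open>(s - 1) / 2\<close>.\<close>
    have tge: "(ln (real N) / real ?s) powr e \<le> sqrt t"
    proof -
      have "(ln (real N) / real ?s) powr e \<le> (real n / real ?s) powr e"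
        using nlog lnN e0 by (intro powr_mono2 divide_right_mono) auto
      also have "\<dots> = sqrt ((real n / real ?s) ^ (?s - 1))"
      proof -
        have pos: "real n / real ?s > 0" using nlog lnN by simp
        have "e = real (?s - 1) * (1 / 2)" using s1 by (simp add: e_def of_nat_diff)
        then have "(real n / real ?s) powr e = ((real n / real ?s) powr real (?s - 1)) powr (1 / 2)"
          by (simp only: powr_powr)
        also have "(real n / real ?s) powr real (?s - 1) = (real n / real ?s) ^ (?s - 1)"
          by (rule powr_realpow[OF pos])
        finally show ?thesis using pos by (simp add: powr_half_sqrt)
      qed
      also have "\<dots> \<le> sqrt t" using card_level_set_ge[of n, where 'n = 'n] by (simp add: t_def)
      finally show ?thesis .
    qed
    have t: "t > 0"
    proof -
      have "0 < (ln (real N) / real ?s) powr e" using lnN by simp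
      with tge show ?thesis by (smt (verit) real_sqrt_le_0_iff)
    qed
    \<comment> \<open>One fooling polynomial per shape: every box with \<open>m\<close> in the level
      set has exactly \<open>2 ^ n\<close> frequencies.\<close>
    have "\<exists>b. \<forall>m\<in>?T. (\<forall>i<N. (\<Sum>h\<in>?box m. b m h * cos_basis h (P i)) = 0)
        \<and> (\<forall>h. h \<notin> ?box m \<longrightarrow> b m h = 0)
        \<and> b m (\<lambda>_. 0) \<ge> 1/2 \<and> (\<Sum>h\<in>?box m. (b m h)\<^sup>2) \<le> 6 ^ ?s"
    proof (intro bchoice ballI)
      fix m assume "m \<in> ?T"
      then have "(\<Prod>j\<in>UNIV. 2 ^ m j) = (2::nat) ^ n" by (simp add: level_set_def flip: power_sum)
      with n(1) show "\<exists>b. (\<forall>i<N. (\<Sum>h\<in>?box m. b h * cos_basis h (P i)) = 0)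
        \<and> (\<forall>h. h \<notin> ?box m \<longrightarrow> b h = 0) \<and> b (\<lambda>_. 0) \<ge> 1/2 \<and> (\<Sum>h\<in>?box m. (b h)\<^sup>2) \<le> 6 ^ ?s"
        by (intro exists_fooling_polynomial) auto
    qed
    then obtain b where b_zero: "\<And>m i. m \<in> ?T \<Longrightarrow> i < N \<Longrightarrow> (\<Sum>h\<in>?box m. b m h * cos_basis h (P i)) = 0"
      and b_supp: "\<And>m h. m \<in> ?T \<Longrightarrow> h \<notin> ?box m \<Longrightarrow> b m h = 0"
      and b_mean: "\<And>m. m \<in> ?T \<Longrightarrow> b m (\<lambda>_. 0) \<ge> 1/2"
      and b_norm: "\<And>m. m \<in> ?T \<Longrightarrow> (\<Sum>h\<in>?box m. (b m h)\<^sup>2) \<le> 6 ^ ?s"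
      by blast
    \<comment> \<open>A common box containing all the doubled boxes, as each \<open>m j\<close> is
      at most \<open>n\<close>.\<close>
    define H :: "('n \<Rightarrow> nat) set" where "H = freq_box (\<lambda>_. 2 * 2 ^ n)"
    have H: "finite H" "(\<lambda>_. 0) \<in> H" by (auto simp: H_def mem_freq_box)
    have sumH: "(\<Sum>h\<in>H. u (b m h) h) = (\<Sum>h\<in>?box m. u (b m h) h)"
      if m: "m \<in> ?T" and u: "\<And>h. u 0 h = (0::real)" for m u
    proof (rule sum.mono_neutral_right[OF H(1)])
      show "?box m \<subseteq> H"
      proof
        fix h assume h: "h \<in> ?box m"
        have "h j < 2 * 2 ^ n" for j
        proof -
          have "h j < 2 * 2 ^ m j" using h by (simp add: mem_freq_box)
          also have "\<dots> \<le> 2 * 2 ^ n" using level_set_le[OF m] by simp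
          finally show ?thesis .
        qed
        then show "h \<in> H" by (simp add: H_def mem_freq_box)
      qed
    qed (use b_supp[OF m] u in auto)
    define A where "A h = (\<Sum>m\<in>?T. b m h)" for h
    define S where "S = E * 2 powr (2 * \<alpha> * real n) * (t * 6 ^ ?s)"
    have S: "S > 0" using E t by (simp add: S_def)
    \<comment> \<open>Cauchy--Schwarz is applied over the active \<open>m\<close> only; their number
      divided by the weight is bounded uniformly in \<open>h\<close>, so the squared norm grows
      linearly in \<open>t\<close> and not quadratically.\<close>
    have A_sq: "(A h)\<^sup>2 / r_vec \<alpha> \<gamma> h \<le> E * 2 powr (2 * \<alpha> * real n) * (\<Sum>m\<in>?T. (b m h)\<^sup>2)" for h
    proof -
      let ?act = "{m \<in> ?T. \<forall>j. h j < 2 * 2 ^ m j}"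
      have r: "r_vec \<alpha> \<gamma> h > 0" using assms r_vec_pos by blast
      have "A h = (\<Sum>m\<in>?act. b m h)"
        unfolding A_def by (rule sum.mono_neutral_right) (auto intro!: b_supp simp: mem_freq_box)
      then have "(A h)\<^sup>2 \<le> (\<Sum>m\<in>?act. (b m h)\<^sup>2) * real (card ?act)"
        by (simp add: sum_squared_le_sum_of_squares)
      also have "\<dots> \<le> (\<Sum>m\<in>?T. (b m h)\<^sup>2) * real (card ?act)"
        by (intro mult_right_mono sum_mono2) auto
      finally have "(A h)\<^sup>2 / r_vec \<alpha> \<gamma> h \<le> (\<Sum>m\<in>?T. (b m h)\<^sup>2) * real (card ?act) / r_vec \<alpha> \<gamma> h"
        using r by (intro divide_right_mono) auto
      also have "\<dots> = (real (card ?act) / r_vec \<alpha> \<gamma> h) * (\<Sum>m\<in>?T. (b m h)\<^sup>2)" by simp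
      also have "\<dots> \<le> E * 2 powr (2 * \<alpha> * real n) * (\<Sum>m\<in>?T. (b m h)\<^sup>2)"
        by (intro mult_right_mono active sum_nonneg) auto
      finally show ?thesis .
    qed
    have A_norm: "(\<Sum>h\<in>H. (A h)\<^sup>2 / r_vec \<alpha> \<gamma> h) \<le> S"
    proof -
      have "(\<Sum>h\<in>H. (A h)\<^sup>2 / r_vec \<alpha> \<gamma> h)
          \<le> (\<Sum>h\<in>H. E * 2 powr (2 * \<alpha> * real n) * (\<Sum>m\<in>?T. (b m h)\<^sup>2))"
        by (intro sum_mono A_sq)
      also have "\<dots> = E * 2 powr (2 * \<alpha> * real n) * (\<Sum>m\<in>?T. \<Sum>h\<in>H. (b m h)\<^sup>2)"
        by (subst sum.swap) (simp add: sum_distrib_left)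
      also have "\<dots> \<le> E * 2 powr (2 * \<alpha> * real n) * (\<Sum>m\<in>?T. 6 ^ ?s)"
        using E b_norm by (intro mult_left_mono sum_mono) (auto simp: sumH[where u = "\<lambda>y h. y\<^sup>2"])
      also have "\<dots> = S" by (simp add: S_def t_def)
      finally show ?thesis .
    qed
    define f where "f x = (\<Sum>h\<in>H. A h / sqrt S * cos_basis h x)" for x :: "real^'n"
    have f: "f \<in> cos_unit_ball \<alpha> \<gamma>"
      unfolding f_def[abs_def] by (rule cos_polynomial_in_unit_ball[OF H(1) A_norm S])
    have fP: "f (P i) = 0" if "i < N" for i
    proof -
      have "f (P i) = (\<Sum>h\<in>H. \<Sum>m\<in>?T. b m h * cos_basis h (P i)) / sqrt S"
        by (simp add: f_def A_def sum_distrib_right sum_divide_distrib)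
      also have "\<dots> = (\<Sum>m\<in>?T. \<Sum>h\<in>H. b m h * cos_basis h (P i)) / sqrt S"
        by (subst sum.swap) simp
      also have "\<dots> = 0"
        using that by (simp add: sumH[where u = "\<lambda>y h. y * cos_basis h (P i)"] b_zero)
      finally show ?thesis .
    qed
    have "C * ln (real N) powr e / real N powr \<alpha>
        = (ln (real N) / real ?s) powr e / (2 * E' * (4 powr \<alpha> * real N powr \<alpha>))"
      using lnN by (simp add: C_def powr_divide)
    \<comment> \<open>The numerator uses the count of shapes, the denominator the upper bound on
      \<open>2 ^ n\<close>.\<close>
    also have "\<dots> \<le> sqrt t / (2 * E' * 2 powr (\<alpha> * real n))"
    proof (rule frac_le)
      have "2 powr (\<alpha> * real n) = (2 ^ n) powr \<alpha>" by (simp add: powr_powr mult.commute flip: powr_realpow)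
      also have "\<dots> \<le> (4 * real N) powr \<alpha>"
      proof (rule powr_mono2)
        show "2 ^ n \<le> 4 * real N" using n(2) by (metis of_nat_le_iff of_nat_mult of_nat_numeral of_nat_power)
      qed (use assms in auto)
      also have "\<dots> = 4 powr \<alpha> * real N powr \<alpha>" by (simp add: powr_mult)
      finally show "2 * E' * 2 powr (\<alpha> * real n) \<le> 2 * E' * (4 powr \<alpha> * real N powr \<alpha>)"
        using E' by simp
    qed (use tge t E' in auto)
    also have "\<dots> = (t / 2) / sqrt S"
    proof -
      have "2 powr (2 * \<alpha> * real n) = (2 powr (\<alpha> * real n))\<^sup>2"
        by (simp add: power2_eq_square mult.assoc flip: powr_add)
      then have "sqrt S = E' * 2 powr (\<alpha> * real n) * sqrt t"
        by (simp add: S_def E'_def real_sqrt_mult)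
      moreover have "sqrt t * sqrt t = t" using t by simp
      ultimately show ?thesis using t E' by (simp add: field_simps)
    qed
    also have "\<dots> \<le> A (\<lambda>_. 0) / sqrt S"
    proof (rule divide_right_mono)
      have "t / 2 = (\<Sum>m\<in>?T. 1 / 2)" by (simp add: t_def)
      also have "\<dots> \<le> A (\<lambda>_. 0)" unfolding A_def by (intro sum_mono b_mean)
      finally show "t / 2 \<le> A (\<lambda>_. 0)" .
    qed (use S in simp)
    also have "\<dots> = integral unit_cube f"
      unfolding f_def integral_cos_polynomial[OF H, of "\<lambda>h. A h / sqrt S"] ..
    also have "\<dots> \<le> wce_cos \<alpha> \<gamma> N P w"
      by (rule wce_cos_ge[OF assms P f fP])
    finally show ?thesis .
  qed
  moreover have "C > 0" using E' s1 by (simp add: C_def)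
  ultimately show ?thesis unfolding e_def by blast
qed

end
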